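(* Let $A_{\rightarrow}$ be the adjacency matrix of the directed cycle on $n$ vertices with unit weights, i.e. with edges $(i,i+1)$, indices taken mod $n$. Then $A_{\rightarrow}$ is a permutation matrix, hence unitary, hence normal. Therefore $\delta(A_{\rightarrow})=0$ while $\alpha(A_{\rightarrow})>0$.
   Context: A directed weighted graph has vertex set $\{1,\ldots,n\}$, a set of directed edges (ordered pairs of vertices), and edge weights $w(i,j)>0$. Its adjacency matrix $A\in\mathbb{R}^{n\times n}$ has entries $A_{ij}=w(i,j)$ if $(i,j)$ is an edge and $A_{ij}=0$ otherwise. The asymmetry index is $\alpha(A):=\dfrac{\|A-A^{\mathrm{T}}\|_F}{\|A\|_F}$ and the (normalized) departure from normality is $\delta(A):=\dfrac{\|AA^*-A^*A\|_F}{\|A\|_F^2}$, where $\|\cdot\|_F$ is the Frobenius norm, $^{\mathrm{T}}$ denotes transpose and $^*$ denotes conjugate transpose. A matrix $A$ is normal if $AA^*=A^*A$.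
   Formalization: The claim α(A→)>0 is stated only for n≥3, since for n=1 (a loop) and n=2 (two opposite edges) the matrix is symmetric and α(A→)=0; all other claims are stated for every n≥1. *)

theory Defs
  imports
    "HOL-Combinatorics.Permutations"
    "HOL-Number_Theory.Cong"
    "Graph_Theory.Pair_Digraph"
    "Graph_Theory.Weighted_Graph"
    "Jordan_Normal_Form.Schur_Decomposition"
begin

locale weighted_digraph = pair_wf_digraph G for G :: "nat pair_pre_digraph" +
  fixes n :: nat and w :: "(nat \<times> nat) weight_fun"
  assumes verts_eq: "pverts G = {1..n}"
    and weight_pos: "e \<in> parcs G \<Longrightarrow> w e > 0"

text \<open>Vertices are numbered from 1 while matrix indices start at 0, so the entry at
  \<open>(i, j)\<close> belongs to the vertex pair \<open>(i + 1, j + 1)\<close>.\<close>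

definition adjacency_mat :: "nat \<Rightarrow> nat pair_pre_digraph \<Rightarrow> (nat \<times> nat) weight_fun \<Rightarrow> real mat" where
  "adjacency_mat n G w =
     mat n n (\<lambda>(i, j). if (Suc i, Suc j) \<in> parcs G then w (Suc i, Suc j) else 0)"

definition directed_cycle :: "nat \<Rightarrow> nat pair_pre_digraph" where
  "directed_cycle n =
     \<lparr> pverts = {1..n},
       parcs = {(i, j). i \<in> {1..n} \<and> j \<in> {1..n} \<and> [j = i + 1] (mod n)} \<rparr>"

definition directed_cycle_mat :: "nat \<Rightarrow> real mat" where
  "directed_cycle_mat n = adjacency_mat n (directed_cycle n) (\<lambda>_. 1)"

lemma weighted_digraph_directed_cycle: "weighted_digraph (directed_cycle n) n (\<lambda>_. 1)"
  by unfold_locales (auto simp: directed_cycle_def)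

definition frobenius_norm :: "'a :: real_normed_field mat \<Rightarrow> real" where
  "frobenius_norm A = sqrt (\<Sum>i<dim_row A. \<Sum>j<dim_col A. (norm (A $$ (i, j)))\<^sup>2)"

definition asymmetry_index :: "'a :: real_normed_field mat \<Rightarrow> real" where
  "asymmetry_index A = frobenius_norm (A - transpose_mat A) / frobenius_norm A"

text \<open>On real matrices \<^const>\<open>conjugate\<close> is the identity, so there \<^const>\<open>mat_adjoint\<close> is
  the transpose.\<close>

definition departure_from_normality ::
    "'a :: {conjugatable_field, real_normed_field} mat \<Rightarrow> real" where
  "departure_from_normality A =
     frobenius_norm (A * mat_adjoint A - mat_adjoint A * A) / (frobenius_norm A)\<^sup>2"

definition normal_mat :: "'a :: conjugatable_field mat \<Rightarrow> bool" where
  "normal_mat A \<longleftrightarrow> square_mat A \<and> A * mat_adjoint A = mat_adjoint A * A"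

definition unitary_mat :: "'a :: conjugatable_field mat \<Rightarrow> bool" where
  "unitary_mat A \<longleftrightarrow>
     square_mat A \<and> inverts_mat A (mat_adjoint A) \<and> inverts_mat (mat_adjoint A) A"

definition permutation_mat :: "'a :: {zero, one} mat \<Rightarrow> bool" where
  "permutation_mat A \<longleftrightarrow>
     (\<exists>p. p permutes {..<dim_row A} \<and>
          A = mat (dim_row A) (dim_row A) (\<lambda>(i, j). if j = p i then 1 else 0))"

end

theory Submission
  imports Defs
begin

text \<open>The cycle matrix has its ones exactly at \<open>(i, (i + 1) mod n)\<close>, so it represents the
  cyclic shift, a permutation. Everything about normality is then a chain of general facts: the
  rows of a permutation matrix are the standard basis vectors in some order, hence orthonormal, and
  so are the columns (\<open>permutation_mat_imp_unitary_mat\<close>); for a unitary matrix both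
  products \<open>A A\<^sup>*\<close> and \<open>A\<^sup>* A\<close> are the identity
  (\<open>unitary_mat_imp_normal_mat\<close>); and \<open>\<delta>\<close> measures the difference of these
  products. Asymmetry comes from the single edge from 1 to 2: a cycle of length at least 3
  contains it but not its reversal, and one entry differing from its mirror image is enough for
  \<open>\<alpha>\<close> to be positive (\<open>asymmetry_index_pos\<close>). For \<open>n \<le> 2\<close> the cyclic shift is
  an involution and its matrix is symmetric, which is why the bound on \<open>n\<close> is needed there.\<close>

lemma mat_adjoint_eq_mat:
  "mat_adjoint A = mat (dim_col A) (dim_row A) (\<lambda>(i, j). conjugate (A $$ (j, i)))"
  by (rule eq_matI) (auto simp: mat_adjoint_def mat_of_rows_def)

text \<open>Entry \<open>(i, j)\<close> of \<open>A A\<^sup>*\<close> is the inner product of the rows \<open>i\<close> and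
  \<open>j\<close>, which are the basis vectors at \<open>p i\<close> and \<open>p j\<close>; injectivity of \<open>p\<close> makes it 1 on
  the diagonal and 0 elsewhere. In \<open>A\<^sup>* A\<close> the columns play this part, with the inverse
  permutation in place of \<open>p\<close>.\<close>

lemma permutation_mat_imp_unitary_mat:
  fixes A :: "'a :: conjugatable_field mat"
  assumes "permutation_mat A"
  shows "unitary_mat A"
proof -
  define m where "m = dim_row A"
  obtain p where p: "p permutes {..<m}"
    and A: "A = mat m m (\<lambda>(i, j). if j = p i then 1 else 0)"
    using assms unfolding permutation_mat_def m_def by blast
  have dims: "dim_row A = m" "dim_col A = m"
    by (subst A, simp)+
  have entry: "A $$ (i, j) = (if j = p i then 1 else 0)" if "i < m" "j < m" for i j
    using that by (subst A) simp
  have conj_one: "conjugate (1 :: 'a) = 1"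
    by (metis conjugate_cancel_iff conjugate_dist_mul conjugate_id mult.right_neutral mult_1)
  have p_less: "p i < m" if "i < m" for i
    using permutes_in_image[OF p, of i] that by simp
  define q where "q = inv_into UNIV p"
  have inv_less: "q i < m" if "i < m" for i
    using permutes_in_image[OF permutes_inv[OF p], of i] that by (simp add: q_def)
  have inj: "p i = p j \<longleftrightarrow> i = j" for i j
    using permutes_inj[OF p] by (simp add: inj_eq)
  have inv_eq: "i = p k \<longleftrightarrow> k = q i" for i k
    using permutes_inverses[OF p] unfolding q_def by metis
  have inv_inj: "q i = q j \<longleftrightarrow> i = j" for i j
    using permutes_inverses[OF p] unfolding q_def by metis
  have "A * mat_adjoint A = 1\<^sub>m m"
  proof (rule eq_matI)
    fix i j assume "i < dim_row (1\<^sub>m m :: 'a mat)" "j < dim_col (1\<^sub>m m :: 'a mat)"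
    then have ij: "i < m" "j < m" by simp_all
    have "(A * mat_adjoint A) $$ (i, j) = (\<Sum>k\<in>{0..<m}. A $$ (i, k) * conjugate (A $$ (j, k)))"
      using ij by (simp add: dims mat_adjoint_eq_mat scalar_prod_def)
    also have "\<dots> = (\<Sum>k\<in>{0..<m}. if k = p i then if i = j then 1 else 0 else 0)"
      using ij by (intro sum.cong) (auto simp: entry conj_one inj)
    also have "\<dots> = 1\<^sub>m m $$ (i, j)"
      using ij p_less by simp
    finally show "(A * mat_adjoint A) $$ (i, j) = 1\<^sub>m m $$ (i, j)" .
  qed (simp_all add: dims mat_adjoint_eq_mat)
  moreover have "mat_adjoint A * A = 1\<^sub>m m"
  proof (rule eq_matI)
    fix i j assume "i < dim_row (1\<^sub>m m :: 'a mat)" "j < dim_col (1\<^sub>m m :: 'a mat)"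
    then have ij: "i < m" "j < m" by simp_all
    have "(mat_adjoint A * A) $$ (i, j) = (\<Sum>k\<in>{0..<m}. conjugate (A $$ (k, i)) * A $$ (k, j))"
      using ij by (simp add: dims mat_adjoint_eq_mat scalar_prod_def)
    also have "\<dots> = (\<Sum>k\<in>{0..<m}. if k = q i then if i = j then 1 else 0 else 0)"
      using ij by (intro sum.cong) (auto simp: entry conj_one inv_eq inv_inj)
    also have "\<dots> = 1\<^sub>m m $$ (i, j)"
      using ij inv_less by simp
    finally show "(mat_adjoint A * A) $$ (i, j) = 1\<^sub>m m $$ (i, j)" .
  qed (simp_all add: dims mat_adjoint_eq_mat)
  ultimately show ?thesis
    by (simp add: unitary_mat_def inverts_mat_def dims mat_adjoint_eq_mat)
qed

lemma unitary_mat_imp_normal_mat: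
  assumes "unitary_mat A"
  shows "normal_mat A"
  using assms by (auto simp: unitary_mat_def normal_mat_def inverts_mat_def mat_adjoint_eq_mat)

lemma departure_from_normality_normal_mat:
  assumes "normal_mat A"
  shows "departure_from_normality A = 0"
proof -
  have "A * mat_adjoint A = mat_adjoint A * A"
    using assms by (simp add: normal_mat_def)
  then show ?thesis
    by (simp add: departure_from_normality_def frobenius_norm_def mat_adjoint_eq_mat)
qed

lemma frobenius_norm_pos:
  assumes "i < dim_row A" "j < dim_col A" "A $$ (i, j) \<noteq> 0"
  shows "frobenius_norm A > 0"
proof -
  have "0 < (\<Sum>j<dim_col A. (norm (A $$ (i, j)))\<^sup>2)"
    using assms by (intro sum_pos2[of _ j]) auto
  then have "0 < (\<Sum>i<dim_row A. \<Sum>j<dim_col A. (norm (A $$ (i, j)))\<^sup>2)"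
    using assms(1) by - (rule sum_pos2[of _ i], auto intro: sum_nonneg)
  then show ?thesis
    by (simp add: frobenius_norm_def)
qed

text \<open>An entry that differs from its mirror image makes both Frobenius norms in the quotient
  positive: two different numbers cannot both vanish, so \<open>A\<close> itself is nonzero as well.\<close>

lemma asymmetry_index_pos:
  assumes "square_mat A" "i < dim_row A" "j < dim_row A" "A $$ (i, j) \<noteq> A $$ (j, i)"
  shows "asymmetry_index A > 0"
proof -
  have "A $$ (i, j) \<noteq> 0 \<or> A $$ (j, i) \<noteq> 0"
    using assms(4) by auto
  then have "frobenius_norm A > 0"
    using assms frobenius_norm_pos[of i A j] frobenius_norm_pos[of j A i] by auto
  moreover have "frobenius_norm (A - transpose_mat A) > 0"
    using assms by (intro frobenius_norm_pos[of i _ j]) auto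
  ultimately show ?thesis
    by (simp add: asymmetry_index_def)
qed

lemma directed_cycle_mat_eq:
  "directed_cycle_mat n = mat n n (\<lambda>(i, j). if j = Suc i mod n then 1 else 0)"
proof (rule eq_matI)
  fix i j
  assume "i < dim_row (mat n n (\<lambda>(i, j). if j = Suc i mod n then 1 else (0 :: real)))"
    and "j < dim_col (mat n n (\<lambda>(i, j). if j = Suc i mod n then 1 else (0 :: real)))"
  then have ij: "i < n" "j < n" by simp_all
  have "[Suc j = Suc i + 1] (mod n) \<longleftrightarrow> [j = Suc i] (mod n)"
    using cong_add_rcancel_nat[of j 1 "Suc i" n] by simp
  also have "\<dots> \<longleftrightarrow> j = Suc i mod n"
    using ij by (simp add: cong_def)
  finally show "directed_cycle_mat n $$ (i, j) =
      mat n n (\<lambda>(i, j). if j = Suc i mod n then 1 else 0) $$ (i, j)"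
    using ij by (auto simp: directed_cycle_mat_def adjacency_mat_def directed_cycle_def)
qed (simp_all add: directed_cycle_mat_def adjacency_mat_def)

lemma cyclic_shift_permutes:
  "(\<lambda>i. if i < n then Suc i mod n else i) permutes {..<n}"
proof (rule bij_imp_permutes)
  let ?s = "\<lambda>i. if i < n then Suc i mod n else i"
  have "inj_on ?s {..<n}"
  proof (rule inj_onI)
    fix i j assume "i \<in> {..<n}" "j \<in> {..<n}" "?s i = ?s j"
    then have ij: "i < n" "j < n" "[i + 1 = j + 1] (mod n)"
      by (simp_all add: cong_def)
    then have "[i = j] (mod n)"
      using cong_add_rcancel_nat by blast
    then show "i = j"
      using ij by (simp add: cong_def)
  qed
  moreover have "?s ` {..<n} \<subseteq> {..<n}"
    by auto
  ultimately show "bij_betw ?s {..<n} {..<n}"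
    unfolding bij_betw_def using endo_inj_surj[of "{..<n}" ?s] by blast
qed auto

lemma permutation_mat_directed_cycle_mat: "permutation_mat (directed_cycle_mat n)"
  unfolding permutation_mat_def
proof (intro exI conjI)
  show "(\<lambda>i. if i < n then Suc i mod n else i) permutes {..<dim_row (directed_cycle_mat n)}"
    using cyclic_shift_permutes by (simp add: directed_cycle_mat_eq)
qed (auto simp: directed_cycle_mat_eq)

lemma asymmetry_index_directed_cycle_mat_pos:
  assumes "n \<ge> 3"
  shows "asymmetry_index (directed_cycle_mat n) > 0"
  \<comment> \<open>The matrix entry at \<open>(0, 1)\<close> belongs to the edge from vertex 1 to vertex 2.\<close>
  using assms by (intro asymmetry_index_pos[of _ 0 1]) (auto simp: directed_cycle_mat_eq)

theorem proposition5p1: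
  fixes n :: nat
  assumes "n \<ge> 1"
  shows "permutation_mat (directed_cycle_mat n) \<and>
         unitary_mat (directed_cycle_mat n) \<and>
         normal_mat (directed_cycle_mat n) \<and>
         departure_from_normality (directed_cycle_mat n) = 0 \<and>
         (n \<ge> 3 \<longrightarrow> asymmetry_index (directed_cycle_mat n) > 0)"
  using permutation_mat_directed_cycle_mat permutation_mat_imp_unitary_mat
    unitary_mat_imp_normal_mat departure_from_normality_normal_mat
    asymmetry_index_directed_cycle_mat_pos by blast

end
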